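(* Let $X$ be a real Banach space with a normalized Schauder basis $(e_n)_{n\in\mathbb N}$ and let $w=(w_n)$ be a weight sequence with $0<\inf_n w_n\le\sup_n w_n<\infty$. If $(e_n)$ satisfies both $w$-left Property $(A)$ and $w$-right Property $(A)$, then $(e_n)$ satisfies $w$-Property $(A)$.
   Context: Let $(e_n^* )$ be the biorthogonal functionals of $(e_n)$, and $\mathrm{supp}(x)=\{n: e_n^*(x)\ne0\}$. A weight sequence $w=(w_n)_{n\in\mathbb N}$ is a sequence of positive real numbers; $w(A)=\sum_{i\in A}w_i$. $\mathbb N^{<\infty}$ is the set of all finite subsets of $\mathbb N$ (including $\emptyset$). $\mathcal A$ is the set of all sequences $\varepsilon=(\varepsilon_i)_{i\in\mathbb N}$ with $\varepsilon_i\in\{1,-1\}$, and $1_{\varepsilon A}=\sum_{i\in A}\varepsilon_ie_i$ for $A\in\mathbb N^{<\infty}$. $A<B$ means that every element of $A$ is smaller than every element of $B$ (so it holds if $A$ or $B$ is empty). Consider, for a constant $C\ge1$, the inequality $( * )$: $\|x+t1_{\varepsilon A}\|\le C\|x+t1_{\eta B}\|$, for $x\in X$, $t\ge\sup_j|e_j^*(x)|$, $\varepsilon,\eta\in\mathcal A$ and $A,B\in\mathbb N^{<\infty}$ with $w(A)\le w(B)$ and $\mathrm{supp}(x)\cap(A\cup B)=\emptyset$. The basis has $w$-Property $(A)$ if there is $C\ge1$ such that $( * )$ holds for all such data with $A\cap B=\emptyset$; it has $w$-left Property $(A)$ if there is $C\ge1$ such that $( * )$ holds for all such data with $A<B$;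 it has $w$-right Property $(A)$ if there is $C\ge1$ such that $( * )$ holds for all such data with $B<A$. *)

theory Defs
  imports "HOL-Analysis.Analysis"
begin

text \<open>Sequences are indexed by the type nat, i.e. from 0; only the order of the indices matters.
  The Banach space is the whole type; the class banach means real Banach spaces.\<close>

definition schauder_basis :: "(nat \<Rightarrow> 'a::banach) \<Rightarrow> bool" where
  "schauder_basis e \<longleftrightarrow> (\<forall>x. \<exists>!a::nat \<Rightarrow> real. (\<lambda>n. a n *\<^sub>R e n) sums x)"

definition normalized_schauder_basis :: "(nat \<Rightarrow> 'a::banach) \<Rightarrow> bool" where
  "normalized_schauder_basis e \<longleftrightarrow> schauder_basis e \<and> (\<forall>n. norm (e n) = 1)"

text \<open>The biorthogonal (coordinate) functionals; meaningful only if \<open>e\<close> is a Schauder basis,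
  see the two lemmas below.\<close>

definition biorth :: "(nat \<Rightarrow> 'a::banach) \<Rightarrow> nat \<Rightarrow> 'a \<Rightarrow> real" where
  "biorth e n x = (THE a::nat \<Rightarrow> real. (\<lambda>k. a k *\<^sub>R e k) sums x) n"

lemma biorth_expansion:
  assumes "schauder_basis e"
  shows "(\<lambda>n. biorth e n x *\<^sub>R e n) sums x"
proof -
  have "\<exists>!a::nat \<Rightarrow> real. (\<lambda>n. a n *\<^sub>R e n) sums x"
    using assms by (simp add: schauder_basis_def)
  from theI'[OF this] show ?thesis
    by (simp add: biorth_def)
qed

lemma biorth_basis:
  assumes "schauder_basis e"
  shows "biorth e m (e n) = (if m = n then 1 else 0)"
proof -
  let ?d = "\<lambda>k. (if k = n then 1 else 0) :: real"
  have "(\<lambda>k. if k = n then e k else 0) sums e n"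
    by (rule sums_single)
  moreover have "(\<lambda>k. ?d k *\<^sub>R e k) = (\<lambda>k. if k = n then e k else 0)"
    by auto
  ultimately have "(\<lambda>k. ?d k *\<^sub>R e k) sums e n"
    by simp
  moreover have "\<exists>!a::nat \<Rightarrow> real. (\<lambda>k. a k *\<^sub>R e k) sums e n"
    using assms by (simp add: schauder_basis_def)
  ultimately have "(THE a::nat \<Rightarrow> real. (\<lambda>k. a k *\<^sub>R e k) sums e n) = ?d"
    by (intro the1_equality)
  then show ?thesis
    by (simp add: biorth_def)
qed

definition supp :: "(nat \<Rightarrow> 'a::banach) \<Rightarrow> 'a \<Rightarrow> nat set" where
  "supp e x = {n. biorth e n x \<noteq> 0}"

definition weight :: "(nat \<Rightarrow> real) \<Rightarrow> bool" where
  "weight w \<longleftrightarrow> (\<forall>n. 0 < w n)"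

definition signs :: "(nat \<Rightarrow> real) set" where
  "signs = {\<epsilon>. \<forall>i. \<epsilon> i \<in> {1, -1}}"

definition signed_ind :: "(nat \<Rightarrow> 'a::banach) \<Rightarrow> (nat \<Rightarrow> real) \<Rightarrow> nat set \<Rightarrow> 'a" where
  "signed_ind e \<epsilon> A = (\<Sum>i\<in>A. \<epsilon> i *\<^sub>R e i)"

definition set_less :: "nat set \<Rightarrow> nat set \<Rightarrow> bool" where
  "set_less A B \<longleftrightarrow> (\<forall>a\<in>A. \<forall>b\<in>B. a < b)"

text \<open>The common part of the three properties: the inequality holds with constant \<open>C\<close> for all
  admissible data whose sets \<open>A\<close>, \<open>B\<close> are moreover in the relation \<open>R\<close>. For a normalized Schauder
  basis the coefficients of \<open>x\<close> tend to 0, so the supremum is a genuine one.\<close>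

definition prop_A_ineq ::
  "(nat set \<Rightarrow> nat set \<Rightarrow> bool) \<Rightarrow> (nat \<Rightarrow> real) \<Rightarrow> (nat \<Rightarrow> 'a::banach) \<Rightarrow> real \<Rightarrow> bool" where
  "prop_A_ineq R w e C \<longleftrightarrow>
     (\<forall>x t \<epsilon> \<eta> A B.
        (SUP j. \<bar>biorth e j x\<bar>) \<le> t \<longrightarrow> \<epsilon> \<in> signs \<longrightarrow> \<eta> \<in> signs \<longrightarrow>
        finite A \<longrightarrow> finite B \<longrightarrow> sum w A \<le> sum w B \<longrightarrow>
        supp e x \<inter> (A \<union> B) = {} \<longrightarrow> R A B \<longrightarrow>
        norm (x + t *\<^sub>R signed_ind e \<epsilon> A) \<le> C * norm (x + t *\<^sub>R signed_ind e \<eta> B))"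

definition w_property_A :: "(nat \<Rightarrow> real) \<Rightarrow> (nat \<Rightarrow> 'a::banach) \<Rightarrow> bool" where
  "w_property_A w e \<longleftrightarrow> (\<exists>C\<ge>1. prop_A_ineq (\<lambda>A B. A \<inter> B = {}) w e C)"

definition w_left_property_A :: "(nat \<Rightarrow> real) \<Rightarrow> (nat \<Rightarrow> 'a::banach) \<Rightarrow> bool" where
  "w_left_property_A w e \<longleftrightarrow> (\<exists>C\<ge>1. prop_A_ineq (\<lambda>A B. set_less A B) w e C)"

definition w_right_property_A :: "(nat \<Rightarrow> real) \<Rightarrow> (nat \<Rightarrow> 'a::banach) \<Rightarrow> bool" where
  "w_right_property_A w e \<longleftrightarrow> (\<exists>C\<ge>1. prop_A_ineq (\<lambda>A B. set_less B A) w e C)"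

end

theory Submission
  imports Defs
begin

text \<open>
  Truncating \<open>x\<close> and passing to the limit, we may assume that \<open>x\<close> is finitely supported. Choose a
  block \<open>D = {M..<M + k}\<close> to the right of everything, with \<open>k\<close> maximal subject to \<open>w(D) \<le> w(B)\<close>.
  Then \<open>w(A) < w({M..M + k})\<close>, so the left property moves \<open>A\<close> to \<open>{M..M + k}\<close>, and the right
  property moves \<open>D\<close> to \<open>B\<close>. The additional index \<open>M + k\<close> costs at most \<open>t\<close>, and \<open>t\<close> is at most
  a multiple of \<open>\<parallel>x + t 1\<^sub>B\<parallel>\<close>, because comparing \<open>\<emptyset>\<close> with a singleton shows that deleting one index
  of \<open>B\<close> increases the norm at most by a constant factor.
\<close>

lemma abs_signs:
  assumes "\<epsilon> \<in> signs"
  shows "\<bar>\<epsilon> n\<bar> = 1"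
proof -
  have "\<epsilon> n \<in> {1, -1}"
    using assms unfolding signs_def by blast
  then show ?thesis
    by auto
qed

lemma biorth_unique:
  assumes "schauder_basis e" and "(\<lambda>n. a n *\<^sub>R e n) sums x"
  shows "biorth e n x = a n"
proof -
  have "\<exists>!a::nat \<Rightarrow> real. (\<lambda>k. a k *\<^sub>R e k) sums x"
    using assms(1) by (simp add: schauder_basis_def)
  then have "(THE a::nat \<Rightarrow> real. (\<lambda>k. a k *\<^sub>R e k) sums x) = a"
    using assms(2) by (intro the1_equality)
  then show ?thesis
    by (simp add: biorth_def)
qed

lemma biorth_add:
  assumes "schauder_basis e"
  shows "biorth e n (x + y) = biorth e n x + biorth e n y"
proof (rule biorth_unique[OF assms])
  show "(\<lambda>n. (biorth e n x + biorth e n y) *\<^sub>R e n) sums (x + y)"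
    using sums_add[OF biorth_expansion[OF assms] biorth_expansion[OF assms], of x y]
    by (simp add: scaleR_add_left)
qed

lemma biorth_scaleR:
  assumes "schauder_basis e"
  shows "biorth e n (c *\<^sub>R x) = c * biorth e n x"
proof (rule biorth_unique[OF assms])
  show "(\<lambda>n. (c * biorth e n x) *\<^sub>R e n) sums (c *\<^sub>R x)"
    using sums_scaleR_right[OF biorth_expansion[OF assms], of c x] by simp
qed

lemma biorth_sum:
  assumes "schauder_basis e" and "finite F"
  shows "biorth e n (\<Sum>i\<in>F. a i *\<^sub>R e i) = (if n \<in> F then a n else 0)"
proof (rule biorth_unique[OF assms(1)])
  have "(\<lambda>n. if n \<in> F then a n *\<^sub>R e n else 0) sums (\<Sum>i\<in>F. a i *\<^sub>R e i)"
    by (rule sums_If_finite_set[OF assms(2)])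
  moreover have "(\<lambda>n. (if n \<in> F then a n else 0) *\<^sub>R e n)
      = (\<lambda>n. if n \<in> F then a n *\<^sub>R e n else 0)"
    by auto
  ultimately show "(\<lambda>n. (if n \<in> F then a n else 0) *\<^sub>R e n) sums (\<Sum>i\<in>F. a i *\<^sub>R e i)"
    by simp
qed

lemma biorth_signed_ind:
  assumes "schauder_basis e" and "finite F"
  shows "biorth e n (signed_ind e \<epsilon> F) = (if n \<in> F then \<epsilon> n else 0)"
  unfolding signed_ind_def by (rule biorth_sum[OF assms])

text \<open>The terms of a convergent expansion tend to 0 and the basis vectors have norm 1, so the
  coordinates are bounded and \<open>SUP\<close> really is an upper bound.\<close>

lemma abs_biorth_le_SUP:
  assumes "normalized_schauder_basis e"
  shows "\<bar>biorth e n x\<bar> \<le> (SUP j. \<bar>biorth e j x\<bar>)"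
proof (rule cSUP_upper)
  have "(\<lambda>n. biorth e n x *\<^sub>R e n) \<longlonglongrightarrow> 0"
    using assms biorth_expansion[of e x]
    by (simp add: normalized_schauder_basis_def summable_LIMSEQ_zero sums_summable)
  then have "Bseq (\<lambda>n. biorth e n x *\<^sub>R e n)"
    by (intro convergent_imp_Bseq convergentI)
  then obtain K where "\<And>n. norm (biorth e n x *\<^sub>R e n) \<le> K"
    by (auto simp: Bseq_def)
  then show "bdd_above (range (\<lambda>j. \<bar>biorth e j x\<bar>))"
    using assms by (intro bdd_aboveI2[of _ _ K]) (simp add: normalized_schauder_basis_def)
qed simp

text \<open>The supremum is replaced by pointwise bounds, which can be read off the coordinates of
  modified or truncated vectors.\<close>

lemma prop_A_ineqD:
  assumes "prop_A_ineq R w e C" and "\<And>j. \<bar>biorth e j x\<bar> \<le> t"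
    and "\<epsilon> \<in> signs" "\<eta> \<in> signs" "finite A" "finite B" "sum w A \<le> sum w B"
    and "supp e x \<inter> (A \<union> B) = {}" "R A B"
  shows "norm (x + t *\<^sub>R signed_ind e \<epsilon> A) \<le> C * norm (x + t *\<^sub>R signed_ind e \<eta> B)"
proof -
  have "(SUP j. \<bar>biorth e j x\<bar>) \<le> t"
    using assms(2) by (intro cSUP_least) auto
  with assms show ?thesis
    unfolding prop_A_ineq_def by blast
qed

text \<open>Deleting one index \<open>j\<close> of \<open>B\<close> changes the vector by a term of
  norm exactly \<open>t\<close>, so \<open>t\<close> is at most the sum of the norms before and
  after deletion. The relation \<open>R\<close> is left open because the property is applied only
  with an empty first set.\<close>

lemma le_norm_add_signed_ind:
  assumes basis: "normalized_schauder_basis e" and w: "weight w"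
    and R: "prop_A_ineq R w e C" "\<And>F. R {} F"
    and x: "\<And>j. \<bar>biorth e j x\<bar> \<le> t" "supp e x \<inter> B = {}"
    and \<eta>: "\<eta> \<in> signs" and B: "finite B" "B \<noteq> {}"
  shows "t \<le> (1 + C) * norm (x + t *\<^sub>R signed_ind e \<eta> B)"
proof -
  have sb: "schauder_basis e" and norm_e: "\<And>n. norm (e n) = 1"
    using basis by (auto simp: normalized_schauder_basis_def)
  have t: "0 \<le> t"
    using x(1)[of 0] by linarith
  obtain j where j: "j \<in> B"
    using B by blast
  define y where "y = x + t *\<^sub>R signed_ind e \<eta> (B - {j})"
  let ?z = "x + t *\<^sub>R signed_ind e \<eta> B"
  note eta = abs_signs[OF \<eta>]
  have biorth_y: "biorth e n y = biorth e n x + t * (if n \<in> B - {j} then \<eta> n else 0)" for n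
    using B by (simp add: y_def biorth_add[OF sb] biorth_scaleR[OF sb] biorth_signed_ind[OF sb])
  have x_B: "biorth e n x = 0" if "n \<in> B" for n
    using x(2) that by (auto simp: supp_def)
  have z: "?z = y + t *\<^sub>R signed_ind e \<eta> {j}"
    using B j by (simp add: y_def signed_ind_def sum.remove[of B j] algebra_simps)
  \<comment> \<open>Here \<open>y\<close> takes the role of \<open>x\<close>. This is admissible: on
    \<open>B - {j}\<close>, where \<open>x\<close> vanishes, its coordinates are
    \<plusminus>\<open>t\<close>; at \<open>j\<close> it is 0, and elsewhere it agrees with
    \<open>x\<close>.\<close>
  have "norm (y + t *\<^sub>R signed_ind e \<eta> {}) \<le> C * norm (y + t *\<^sub>R signed_ind e \<eta> {j})"
  proof (rule prop_A_ineqD[OF R(1)])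
    show "\<bar>biorth e n y\<bar> \<le> t" for n
      using x(1)[of n] x_B[of n] eta[of n] t by (auto simp: biorth_y abs_mult)
    show "supp e y \<inter> ({} \<union> {j}) = {}"
      using x_B[OF j] by (simp add: supp_def biorth_y)
    show "sum w {} \<le> sum w {j}"
      using w by (simp add: weight_def less_imp_le)
  qed (use \<eta> R in auto)
  then have "norm y \<le> C * norm ?z"
    unfolding z by (simp add: signed_ind_def)
  moreover have "t = norm (?z - y)"
    unfolding z using t by (simp add: signed_ind_def abs_mult eta norm_e)
  moreover have "norm (?z - y) \<le> norm ?z + norm y"
    by (rule norm_triangle_ineq4)
  ultimately show ?thesis
    by (simp add: distrib_right)
qed

text \<open>Block sums starting at \<open>M\<close> grow at least linearly in the length, so they
  eventually exceed \<open>s\<close>. The predecessor of the least such length is the required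
  \<open>k\<close>.\<close>

lemma ex_block_sum_between:
  fixes w :: "nat \<Rightarrow> real"
  assumes "0 < \<delta>" "\<And>n. \<delta> \<le> w n" "0 \<le> s"
  obtains k where "sum w {M..<M + k} \<le> s" "s < sum w {M..<M + Suc k}"
proof -
  have lower: "real k * \<delta> \<le> sum w {M..<M + k}" for k
    using sum_bounded_below[of "{M..<M + k}" \<delta> w] assms(2) by simp
  obtain k0 where "s < real k0 * \<delta>"
    using reals_Archimedean3[OF assms(1)] by blast
  then have ex: "s < sum w {M..<M + k0}"
    using lower[of k0] by linarith
  define l where "l = (LEAST k. s < sum w {M..<M + k})"
  have l: "s < sum w {M..<M + l}"
    unfolding l_def using ex by (rule LeastI)
  \<comment> \<open>The empty block has sum 0, which does not exceed \<open>s\<close>, so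
    \<open>l\<close> is positive.\<close>
  then obtain k where k: "l = Suc k"
    using assms(3) by (cases l) auto
  then have "\<not> s < sum w {M..<M + k}"
    by (metis l_def lessI not_less_Least)
  then show ?thesis
    using that[of k] l k by simp
qed

text \<open>Finite support leaves room for a block beyond all sets involved. In the constant, the
  outer \<open>C\<close> comes from moving \<open>A\<close> to the longer block, \<open>C'\<close>
  from moving the shorter block to \<open>B\<close>, and \<open>1 + C\<close> from the index
  \<open>M + k\<close>.\<close>

lemma prop_A_ineq_finite_supp:
  assumes basis: "normalized_schauder_basis e" and w: "weight w" "0 < \<delta>" "\<And>n. \<delta> \<le> w n"
    and left: "1 \<le> C" "prop_A_ineq (\<lambda>A B. set_less A B) w e C"
    and right: "prop_A_ineq (\<lambda>A B. set_less B A) w e C'"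
    and x: "\<And>j. \<bar>biorth e j x\<bar> \<le> t" "supp e x \<inter> (A \<union> B) = {}" "finite (supp e x)"
    and signs: "\<epsilon> \<in> signs" "\<eta> \<in> signs"
    and AB: "finite A" "finite B" "B \<noteq> {}" "sum w A \<le> sum w B"
  shows "norm (x + t *\<^sub>R signed_ind e \<epsilon> A)
    \<le> C * (C' + 1 + C) * norm (x + t *\<^sub>R signed_ind e \<eta> B)"
proof -
  have norm_e: "\<And>n. norm (e n) = 1"
    using basis by (auto simp: normalized_schauder_basis_def)
  have t: "0 \<le> t"
    using x(1)[of 0] by linarith
  have "finite (supp e x \<union> A \<union> B)"
    using x(3) AB by simp
  then obtain M where M: "\<And>n. n \<in> supp e x \<union> A \<union> B \<Longrightarrow> n < M"
    unfolding finite_nat_set_iff_bounded by blast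
  have "0 \<le> sum w B"
    using w(1) by (intro sum_nonneg) (simp add: weight_def less_imp_le)
  then obtain k where k: "sum w {M..<M + k} \<le> sum w B" "sum w B < sum w {M..<M + Suc k}"
    by (rule ex_block_sum_between[OF w(2,3)])
  let ?z = "x + t *\<^sub>R signed_ind e \<eta> B"
  \<comment> \<open>The longer block outweighs \<open>B\<close>, hence also \<open>A\<close>. Both
    blocks carry the signs \<epsilon>, so the two resulting vectors differ in a single term.\<close>
  have 1: "norm (x + t *\<^sub>R signed_ind e \<epsilon> A)
      \<le> C * norm (x + t *\<^sub>R signed_ind e \<epsilon> {M..<M + Suc k})"
  proof (rule prop_A_ineqD[OF left(2) x(1)])
    show "supp e x \<inter> (A \<union> {M..<M + Suc k}) = {}"
      using x(2) M by fastforce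
    show "set_less A {M..<M + Suc k}"
      using M by (fastforce simp: set_less_def)
  qed (use signs AB k in auto)
  have 2: "norm (x + t *\<^sub>R signed_ind e \<epsilon> {M..<M + k}) \<le> C' * norm ?z"
  proof (rule prop_A_ineqD[OF right x(1)])
    show "supp e x \<inter> ({M..<M + k} \<union> B) = {}"
      using x(2) M by fastforce
    show "set_less B {M..<M + k}"
      using M by (fastforce simp: set_less_def)
  qed (use signs AB k in auto)
  have 3: "t \<le> (1 + C) * norm ?z"
    using x AB signs by (intro le_norm_add_signed_ind[OF basis w(1) left(2)])
      (auto simp: set_less_def)
  \<comment> \<open>The difference of the two vectors is
    \<plusminus>\<open>t *\<^sub>R e (M + k)\<close>, of norm \<open>t\<close>.\<close>
  have "norm (x + t *\<^sub>R signed_ind e \<epsilon> {M..<M + Suc k})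
      \<le> norm (x + t *\<^sub>R signed_ind e \<epsilon> {M..<M + k}) + t"
    using norm_triangle_ineq[of "x + t *\<^sub>R signed_ind e \<epsilon> {M..<M + k}"
        "t *\<^sub>R \<epsilon> (M + k) *\<^sub>R e (M + k)"] t
    by (simp add: signed_ind_def norm_e abs_mult abs_signs[OF signs(1)] algebra_simps)
  also have "\<dots> \<le> (C' + 1 + C) * norm ?z"
    using 2 3 by (simp add: algebra_simps)
  finally have "C * norm (x + t *\<^sub>R signed_ind e \<epsilon> {M..<M + Suc k})
      \<le> C * ((C' + 1 + C) * norm ?z)"
    using left(1) by (intro mult_left_mono) auto
  with 1 show ?thesis
    by (simp add: mult.assoc)
qed

theorem theorem3p17:
  fixes e :: "nat \<Rightarrow> 'a::banach" and w :: "nat \<Rightarrow> real"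
  assumes "normalized_schauder_basis e"
    and "weight w"
    and "0 < (INF n. w n)"
    and "bdd_above (range w)"
    and "w_left_property_A w e"
    and "w_right_property_A w e"
  shows "w_property_A w e"
proof -
  have sb: "schauder_basis e"
    using assms(1) by (simp add: normalized_schauder_basis_def)
  obtain C where C: "1 \<le> C" "prop_A_ineq (\<lambda>A B. set_less A B) w e C"
    using assms(5) by (auto simp: w_left_property_A_def)
  obtain C' where C': "1 \<le> C'" "prop_A_ineq (\<lambda>A B. set_less B A) w e C'"
    using assms(6) by (auto simp: w_right_property_A_def)
  let ?K = "C * (C' + 1 + C)"
  have K: "1 \<le> ?K"
    using mult_mono[of 1 C 1 "C' + 1 + C"] C C' by simp
  \<comment> \<open>Positivity bounds the weights below, so the infimum is a true lower bound and
    can serve as \<delta>.\<close>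
  have w_ge: "(INF n. w n) \<le> w n" for n
    using assms(2) by (intro cINF_lower bdd_belowI2[of _ 0]) (auto simp: weight_def less_imp_le)
  have "prop_A_ineq (\<lambda>A B. A \<inter> B = {}) w e ?K"
    unfolding prop_A_ineq_def
  proof (intro allI impI)
    fix x t \<epsilon> \<eta> and A B :: "nat set"
    assume t: "(SUP j. \<bar>biorth e j x\<bar>) \<le> t" and signs: "\<epsilon> \<in> signs" "\<eta> \<in> signs"
      and fin: "finite A" "finite B" and wAB: "sum w A \<le> sum w B"
      and sx: "supp e x \<inter> (A \<union> B) = {}"
    show "norm (x + t *\<^sub>R signed_ind e \<epsilon> A) \<le> ?K * norm (x + t *\<^sub>R signed_ind e \<eta> B)"
    \<comment> \<open>There is no index to delete from an empty \<open>B\<close>. In that case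
      positive weights force \<open>A\<close> to be empty too, and both vectors equal
      \<open>x\<close>.\<close>
    proof (cases "B = {}")
      case True
      have "A = {}"
      proof (rule ccontr)
        assume "A \<noteq> {}"
        then have "0 < sum w A"
          using fin assms(2) by (intro sum_pos) (auto simp: weight_def)
        with wAB True show False
          by simp
      qed
      with True K show ?thesis
        using mult_right_mono[of 1 ?K "norm x"] by (simp add: signed_ind_def)
    next
      case False
      \<comment> \<open>Truncation only replaces coordinates by 0, so the bound by \<open>t\<close>
        and the disjointness from \<open>A\<close> and \<open>B\<close> survive. The constant does
        not depend on \<open>N\<close>, and the inequality passes to the limit by continuity of the
        norm.\<close>
      define S where "S N = (\<Sum>i<N. biorth e i x *\<^sub>R e i)" for N
      have S_lim: "S \<longlonglongrightarrow> x"
        using biorth_expansion[OF sb, of x] by (simp add: S_def[abs_def] sums_def)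
      have bS: "biorth e n (S N) = (if n < N then biorth e n x else 0)" for n N
        unfolding S_def using biorth_sum[OF sb, of "{..<N}"] by simp
      have le_t: "\<bar>biorth e n x\<bar> \<le> t" for n
        using abs_biorth_le_SUP[OF assms(1), of n x] t by linarith
      have "norm (S N + t *\<^sub>R signed_ind e \<epsilon> A) \<le> ?K * norm (S N + t *\<^sub>R signed_ind e \<eta> B)" for N
      proof (rule prop_A_ineq_finite_supp[OF assms(1-3) w_ge C C'(2) _ _ _ signs fin False wAB])
        show "\<bar>biorth e j (S N)\<bar> \<le> t" for j
          using le_t[of j] by (auto simp: bS)
        have "supp e (S N) \<subseteq> supp e x" and "supp e (S N) \<subseteq> {..<N}"
          by (auto simp: supp_def bS split: if_splits)
        with sx show "supp e (S N) \<inter> (A \<union> B) = {}" "finite (supp e (S N))"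
          by (blast, blast intro: finite_subset finite_lessThan)
      qed
      then show ?thesis
        using S_lim
        by (intro LIMSEQ_le[of "\<lambda>N. norm (S N + t *\<^sub>R signed_ind e \<epsilon> A)" _
              "\<lambda>N. ?K * norm (S N + t *\<^sub>R signed_ind e \<eta> B)"] tendsto_intros) auto
    qed
  qed
  with K show ?thesis
    unfolding w_property_A_def by blast
qed

end
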